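(* Let $n,k,m$ be positive integers with $n\ge k\ge 1$, $n-m\ge 1$ and $n-k\ge 1$. Then the binomial Ward-Lah numbers $B(n,k)$ satisfy $$B(n,k)=\frac{(2n)!}{k!(n-k)!}\sum_{j=0}^{m}\frac{(k-j)!\,(n-m-k+j)!}{(2(n-m))!}\binom{m}{j}\,B(n-m,k-j),$$ where terms with $k-j<0$ or $k-j>n-m$ are interpreted as $0$.
   Context: Partition transformation: for integers $n,k\ge 0$ and a sequence $a_1,a_2,\dots$, $$P_n^k(a_1,a_2,\dots)=\sum_{q}(-1)^{q_0}\prod_{j=0}^{\ell(q)-1}\binom{q_j}{q_{j+1}}a_{j+1}^{q_j},$$ where the sum is over integer partitions $q=(q_0\ge q_1\ge\dots)$ of $n=q_0+q_1+\cdots$ with $q_0=k$; $\ell(q)$ is the length of $q$ (number of positive parts), so $q_{\ell(q)-1}>0$ and $q_{\ell(q)}=0$. Binomial Ward-Lah numbers: for integers $n\ge k\ge 0$, $B(n,k)=(-1)^k \dfrac{(2n)!}{k!(n-k)!}\,P_n^k(1,1,\dots)$ (all $a_i=1$), with $B(0,0)=1$, $B(n,0)=0$ for $n\ge 1$, $B(0,k)=0$ for $k\ge 1$, and $B(n,k)=0$ for $k>n$. *)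

theory Defs
  imports Complex_Main
begin

text \<open>
  An integer partition of \<open>n\<close> is an infinite, weakly decreasing, eventually zero sequence
  \<open>q 0 \<ge> q 1 \<ge> \<dots>\<close> of natural numbers with sum \<open>n\<close>; the parts are its positive values.
  Thus \<open>q 0\<close> is the largest part, and is \<open>0\<close> for the empty partition of \<open>0\<close>.
\<close>

definition partitions :: "nat \<Rightarrow> (nat \<Rightarrow> nat) set" where
  "partitions n = {q. antimono q \<and> finite {j. 0 < q j} \<and> (\<Sum>j\<in>{j. 0 < q j}. q j) = n}"

definition partition_length :: "(nat \<Rightarrow> nat) \<Rightarrow> nat" where
  "partition_length q = card {j. 0 < q j}"

text \<open>
  The sequence \<open>a\<close> is indexed from \<open>1\<close>; the value \<open>a 0\<close> is never used.
\<close>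

definition partition_transform ::
    "nat \<Rightarrow> nat \<Rightarrow> (nat \<Rightarrow> 'a::comm_ring_1) \<Rightarrow> 'a" where
  "partition_transform n k a =
     (\<Sum>q\<in>{q \<in> partitions n. q 0 = k}.
        (-1) ^ q 0 * (\<Prod>j<partition_length q. of_nat (q j choose q (j + 1)) * a (j + 1) ^ q j))"

definition binomial_ward_lah :: "nat \<Rightarrow> nat \<Rightarrow> rat" where
  "binomial_ward_lah n k =
     (if k \<le> n
      then (-1) ^ k * (fact (2 * n) / (fact k * fact (n - k))) * partition_transform n k (\<lambda>_. 1)
      else 0)"

text \<open>
  The index set of the sum in \<^const>\<open>partition_transform\<close> is finite.
\<close>

lemma finite_partitions: "finite (partitions n)"
proof (rule finite_subset)
  show "partitions n \<subseteq> {q. \<forall>j. (j \<in> {..<n} \<longrightarrow> q j \<in> {..n}) \<and> (j \<notin> {..<n} \<longrightarrow> q j = 0)}"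
  proof (intro subsetI CollectI allI conjI impI)
    fix q j
    assume q: "q \<in> partitions n"
    then have anti: "antimono q" and fin: "finite {j. 0 < q j}"
      and sum: "(\<Sum>j\<in>{j. 0 < q j}. q j) = n"
      by (auto simp: partitions_def)
    show "q j \<in> {..n}"
      using member_le_sum[of j "{j. 0 < q j}" q] fin sum by (cases "q j = 0") auto
    show "q j = 0" if "j \<notin> {..<n}"
    proof (rule ccontr)
      assume "q j \<noteq> 0"
      have "{..j} \<subseteq> {j. 0 < q j}"
      proof
        fix i
        assume "i \<in> {..j}"
        then have "q j \<le> q i" using anti by (simp add: antimonoD)
        with \<open>q j \<noteq> 0\<close> show "i \<in> {j. 0 < q j}" by simp
      qed
      then have "Suc j \<le> card {j. 0 < q j}"
        using card_mono[OF fin, of "{..j}"] by simp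
      also have "\<dots> = (\<Sum>j\<in>{j. 0 < q j}. 1)" by simp
      also have "\<dots> \<le> (\<Sum>j\<in>{j. 0 < q j}. q j)" by (rule sum_mono) auto
      finally show False using that sum by simp
    qed
  qed
  show "finite {q. \<forall>j. (j \<in> {..<n} \<longrightarrow> q j \<in> {..n}) \<and> (j \<notin> {..<n} \<longrightarrow> q j = (0::nat))}"
    by (rule finite_set_of_finite_funs) auto
qed

text \<open>
  The boundary values, usually listed as separate conventions, follow from the formula.
\<close>

lemma partitions_largest_0: "{q \<in> partitions n. q 0 = 0} = (if n = 0 then {\<lambda>_. 0} else {})"
proof -
  have "q = (\<lambda>_. 0)" if "antimono q" "q 0 = 0" for q :: "nat \<Rightarrow> nat"
  proof
    fix j
    show "q j = 0" using antimonoD[OF that(1), of 0 j] that(2) by simp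
  qed
  then have "q = (\<lambda>_. 0)" if "q \<in> partitions n" "q 0 = 0" for q
    using that by (simp add: partitions_def)
  moreover have "(\<lambda>_. 0) \<in> partitions n \<longleftrightarrow> n = 0"
    by (auto simp: partitions_def antimono_def)
  ultimately show ?thesis by auto
qed

lemma binomial_ward_lah_0_0: "binomial_ward_lah 0 0 = 1"
  by (simp add: binomial_ward_lah_def partition_transform_def partitions_largest_0 partition_length_def)

lemma binomial_ward_lah_n_0: "n \<ge> 1 \<Longrightarrow> binomial_ward_lah n 0 = 0"
  by (simp add: binomial_ward_lah_def partition_transform_def partitions_largest_0)

lemma binomial_ward_lah_eq_0: "n < k \<Longrightarrow> binomial_ward_lah n k = 0"
  by (simp add: binomial_ward_lah_def)

end

theory Submission
  imports Defs
begin

text \<open>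
  Removing the largest part of a partition gives a recursion for the partition transform. At
  \<open>a = (1, 1, \<dots>)\<close> it is solved, up to the sign \<open>(-1)^k\<close>, by the number of compositions of \<open>n\<close>
  into \<open>k\<close> parts: \<open>q j\<close> is the number of parts exceeding \<open>j\<close>, and the binomial
  coefficients choose their positions. Since these numbers are binomial coefficients, both the
  recursion and the theorem reduce to Vandermonde's convolution.
\<close>

text \<open>\<open>case_nat k r\<close> puts \<open>k\<close> in front of the sequence
  \<open>r\<close>; this models attaching a new largest part to a partition, with every old index
  shifted by one.\<close>

lemma case_nat_support:
  fixes k :: nat
  assumes "0 < k"
  shows "{j. 0 < (case_nat k r j :: nat)} = insert 0 (Suc ` {j. 0 < r j})"
proof (rule set_eqI)
  show "j \<in> {j. 0 < (case_nat k r j :: nat)} \<longleftrightarrow> j \<in> insert 0 (Suc ` {j. 0 < r j})" for j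
    using assms by (cases j) auto
qed

lemma partition_length_case_nat:
  assumes "0 < k" "finite {j. 0 < r j}"
  shows "partition_length (case_nat k r) = Suc (partition_length r)"
  using assms by (simp add: partition_length_def case_nat_support card_image)

lemma antimono_case_nat_iff:
  fixes r :: "nat \<Rightarrow> 'a::order"
  shows "antimono (case_nat k r) \<longleftrightarrow> r 0 \<le> k \<and> antimono r"
  by (auto simp: antimono_iff_le_Suc split: nat.splits)

text \<open>This is the bijection behind the recursion. The conjunct \<open>k \<le> n\<close> is
  explicit because \<open>n - k\<close> truncates: for \<open>k > n\<close> the zero sequence would
  otherwise qualify.\<close>

lemma case_nat_in_partitions_iff:
  assumes "0 < k"
  shows "case_nat k r \<in> partitions n \<longleftrightarrow> k \<le> n \<and> r 0 \<le> k \<and> r \<in> partitions (n - k)"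
proof -
  have fin: "finite (insert 0 (Suc ` {j. 0 < r j})) \<longleftrightarrow> finite {j. 0 < r j}"
    by (simp add: finite_image_iff)
  have sum: "(\<Sum>j\<in>insert 0 (Suc ` {j. 0 < r j}). case_nat k r j) = k + (\<Sum>j\<in>{j. 0 < r j}. r j)"
    if "finite {j. 0 < r j}"
    using that by (simp add: sum.reindex)
  show ?thesis
    unfolding partitions_def mem_Collect_eq antimono_case_nat_iff case_nat_support[OF assms] fin
    using sum by auto
qed

lemma partition_transform_eq_0: "n < k \<Longrightarrow> partition_transform n k a = 0"
proof -
  assume "n < k"
  have "q 0 \<le> n" if "q \<in> partitions n" for q
    using that member_le_sum[of 0 "{j. 0 < q j}" q]
    by (cases "q 0 = 0") (auto simp: partitions_def)
  then have "{q \<in> partitions n. q 0 = k} = {}"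
    using \<open>n < k\<close> by force
  then show ?thesis
    unfolding partition_transform_def by (simp only: sum.empty)
qed

lemma partition_transform_0_right: "partition_transform n 0 a = (if n = 0 then 1 else 0)"
  by (simp add: partition_transform_def partitions_largest_0 partition_length_def)

text \<open>The sum is grouped by the second part \<open>i\<close>. The factor
  \<open>(-1) ^ i\<close> cancels the sign inside the smaller transform, since only the largest part
  of the whole partition determines its sign.\<close>

lemma partition_transform_rec:
  fixes a :: "nat \<Rightarrow> 'a::comm_ring_1"
  assumes "0 < k" "k \<le> n"
  shows "partition_transform n k a =
    (-1) ^ k * a 1 ^ k * (\<Sum>i\<le>k. (-1) ^ i * of_nat (k choose i) *
      partition_transform (n - k) i (\<lambda>j. a (j + 1)))"
proof -
  define Q where "Q i = {q \<in> partitions (n - k). q 0 = i}" for i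
  define w :: "(nat \<Rightarrow> 'a) \<Rightarrow> (nat \<Rightarrow> nat) \<Rightarrow> 'a" where
    "w a q = (\<Prod>j<partition_length q. of_nat (q j choose q (j + 1)) * a (j + 1) ^ q j)" for a q
  have finQ: "finite (Q i)" for i
    by (simp add: Q_def finite_partitions)
  have "q \<in> case_nat k ` (\<Union>i\<le>k. Q i)" if "q \<in> partitions n" "q 0 = k" for q
  proof -
    have q: "q = case_nat k (\<lambda>j. q (Suc j))"
      using that(2) by (auto split: nat.splits)
    then have "case_nat k (\<lambda>j. q (Suc j)) \<in> partitions n"
      using that(1) by simp
    then have "(\<lambda>j. q (Suc j)) \<in> (\<Union>i\<le>k. Q i)"
      using case_nat_in_partitions_iff[OF assms(1)] by (auto simp: Q_def)
    with q show ?thesis by (rule image_eqI)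
  qed
  then have img: "{q \<in> partitions n. q 0 = k} = case_nat k ` (\<Union>i\<le>k. Q i)"
    using assms by (auto simp: Q_def case_nat_in_partitions_iff)
  have inj: "inj_on (case_nat k) (\<Union>i\<le>k. Q i)"
    by (rule inj_onI) (metis old.nat.simps(5) ext)
  \<comment> \<open>The length grows by one, so the factor at index 0 splits off and the others see
    the shifted sequence.\<close>
  have w: "w a (case_nat k r) = of_nat (k choose i) * a 1 ^ k * w (\<lambda>j. a (j + 1)) r"
    if "r \<in> Q i" for r i
  proof -
    have "finite {j. 0 < r j}" "r 0 = i"
      using that by (auto simp: Q_def partitions_def)
    then show ?thesis
      using assms(1) by (simp add: w_def partition_length_case_nat prod.lessThan_Suc_shift del: prod.lessThan_Suc)
  qed
  have T: "partition_transform (n - k) i b = (-1) ^ i * (\<Sum>r\<in>Q i. w b r)" for i b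
    unfolding partition_transform_def Q_def w_def sum_distrib_left by (rule sum.cong) auto
  have "partition_transform n k a = (-1) ^ k * (\<Sum>q\<in>case_nat k ` (\<Union>i\<le>k. Q i). w a q)"
    unfolding partition_transform_def img[symmetric] w_def sum_distrib_left
    by (rule sum.cong) auto
  also have "(\<Sum>q\<in>case_nat k ` (\<Union>i\<le>k. Q i). w a q) = (\<Sum>r\<in>(\<Union>i\<le>k. Q i). w a (case_nat k r))"
    by (simp add: sum.reindex[OF inj])
  also have "\<dots> = (\<Sum>i\<le>k. \<Sum>r\<in>Q i. w a (case_nat k r))"
    by (rule sum.UNION_disjoint) (use finQ in \<open>auto simp: Q_def\<close>)
  also have "\<dots> = (\<Sum>i\<le>k. \<Sum>r\<in>Q i. of_nat (k choose i) * a 1 ^ k * w (\<lambda>j. a (j + 1)) r)"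
    by (intro sum.cong refl w)
  also have "\<dots> = a 1 ^ k * (\<Sum>i\<le>k. (-1) ^ i * of_nat (k choose i) *
      partition_transform (n - k) i (\<lambda>j. a (j + 1)))"
    by (simp add: T sum_distrib_left mult_ac)
  finally show ?thesis by (simp add: mult.assoc)
qed

text \<open>The zero cases are separate because truncated subtraction would make the binomial
  coefficient 1 at \<open>(1, 0)\<close> and \<open>(0, 1)\<close>.\<close>

definition compositions :: "nat \<Rightarrow> nat \<Rightarrow> nat" where
  "compositions n k =
     (if n = 0 \<or> k = 0 then if n = k then 1 else 0 else (n - 1) choose (k - 1))"

lemma compositions_convolution:
  assumes "0 < n"
  shows "(\<Sum>j\<le>k. (m choose j) * compositions n (k - j)) = compositions (n + m) k"
proof (cases k)
  case 0
  then show ?thesis using assms by (simp add: compositions_def)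
next
  case (Suc l)
  have "(\<Sum>j\<le>k. (m choose j) * compositions n (k - j)) =
      (\<Sum>j\<le>l. (m choose j) * ((n - 1) choose (l - j)))"
    using assms by (auto simp: Suc compositions_def Suc_diff_le intro!: sum.cong)
  also have "\<dots> = (m + (n - 1)) choose l"
    by (rule vandermonde)
  finally show ?thesis
    using assms by (simp add: Suc compositions_def add.commute)
qed

lemma partition_transform_one:
  "partition_transform n k (\<lambda>_. 1) = (-1) ^ k * (of_nat (compositions n k) :: 'a::comm_ring_1)"
proof (induction n arbitrary: k rule: less_induct)
  case (less n)
  consider "k = 0" | "n < k" | "0 < k" "k = n" | "0 < k" "k < n"
    by linarith
  then show ?case
  proof cases
    case 1
    then show ?thesis by (simp add: partition_transform_0_right compositions_def)
  next
    case 2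
    then show ?thesis by (simp add: partition_transform_eq_0 compositions_def binomial_eq_0)
  next
    \<comment> \<open>Nothing is left after removing the largest part, so only \<open>i = 0\<close>
      contributes. The convolution lemma needs a positive remainder and does not cover this
      case.\<close>
    case 3
    have "partition_transform n k (\<lambda>_. 1 :: 'a) =
        (-1) ^ k * (\<Sum>i\<le>k. (-1) ^ i * of_nat (k choose i) * ((-1) ^ i * of_nat (compositions 0 i)))"
      using 3 less.IH[of 0] by (simp add: partition_transform_rec)
    also have "(\<Sum>i\<le>k. (-1) ^ i * of_nat (k choose i) * ((-1) ^ i * of_nat (compositions 0 i))) =
        (\<Sum>i\<le>k. if i = 0 then 1 else (0 :: 'a))"
      by (rule sum.cong) (auto simp: compositions_def)
    finally show ?thesis
      using 3 by (simp add: compositions_def)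
  next
    case 4
    have "partition_transform n k (\<lambda>_. 1 :: 'a) =
        (-1) ^ k * (\<Sum>i\<le>k. (-1) ^ i * of_nat (k choose i) *
          ((-1) ^ i * of_nat (compositions (n - k) i)))"
      using 4 less.IH[of "n - k"] by (simp add: partition_transform_rec)
    also have "\<dots> = (-1) ^ k * of_nat (\<Sum>i\<le>k. (k choose i) * compositions (n - k) i)"
      by (simp add: mult_ac)
    \<comment> \<open>Reversing the index by symmetry of the binomial coefficients gives the
      convolution with \<open>m = k\<close>.\<close>
    also have "(\<Sum>i\<le>k. (k choose i) * compositions (n - k) i) =
        (\<Sum>i\<le>k. (k choose i) * compositions (n - k) (k - i))"
      by (rule sum.reindex_bij_witness[where i = "\<lambda>i. k - i" and j = "\<lambda>i. k - i"])
         (auto simp: binomial_symmetric[symmetric])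
    also have "\<dots> = compositions n k"
      using 4 by (simp add: compositions_convolution)
    finally show ?thesis .
  qed
qed

lemma binomial_ward_lah_eq_compositions:
  assumes "k \<le> n"
  shows "binomial_ward_lah n k =
    fact (2 * n) / (fact k * fact (n - k)) * of_nat (compositions n k)"
  using assms
  by (simp add: binomial_ward_lah_def partition_transform_one mult_ac)

theorem theorem6p6:
  fixes n k m :: nat
  assumes "k \<ge> 1" and "n \<ge> k" and "m \<ge> 1" and "n - m \<ge> 1" and "n - k \<ge> 1"
  shows "binomial_ward_lah n k =
    fact (2 * n) / (fact k * fact (n - k)) *
      (\<Sum>j = 0..m.
         if j \<le> k \<and> k - j \<le> n - m
         then fact (k - j) * fact (n - m - (k - j)) / fact (2 * (n - m))
                * of_nat (m choose j) * binomial_ward_lah (n - m) (k - j)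
         else 0)"
proof -
  have "(\<Sum>j = 0..m.
         if j \<le> k \<and> k - j \<le> n - m
         then fact (k - j) * fact (n - m - (k - j)) / fact (2 * (n - m))
                * of_nat (m choose j) * binomial_ward_lah (n - m) (k - j)
         else 0) =
      (\<Sum>j = 0..m. if j \<le> k then of_nat ((m choose j) * compositions (n - m) (k - j)) else 0)"
    \<comment> \<open>The factorials cancel the prefactor of the smaller Ward-Lah number. The guard
      \<open>k - j \<le> n - m\<close> can go because \<open>compositions\<close> vanishes beyond
      it.\<close>
    by (rule sum.cong)
       (use assms in \<open>auto simp: binomial_ward_lah_eq_compositions compositions_def\<close>)
  also have "\<dots> = (\<Sum>j\<le>k. of_nat ((m choose j) * compositions (n - m) (k - j)))"
    \<comment> \<open>The ranges differ only in zero terms: the guard fails for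
      \<open>j > k\<close>, and \<open>m choose j\<close> is 0 for \<open>j > m\<close>.\<close>
    by (rule sum.mono_neutral_cong) auto
  also have "\<dots> = of_nat (compositions n k)"
    unfolding of_nat_sum[symmetric] using assms by (simp add: compositions_convolution)
  finally show ?thesis
    using assms by (simp add: binomial_ward_lah_eq_compositions)
qed

end
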